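(* Let $B$ be a finite-dimensional algebra over a field $\Bbbk$, let $A=B\oplus D(B)$ be its trivial extension, and let $\mathfrak{Jac}(A)\in H^1(\mathrm{Aut}(A),A^\times)$ be its Nakayama Jacobian class. Regard the group $B^\times\cap Z(B)$ of central units of $B$ as a subgroup of $\mathrm{Aut}(A)$ via $z\mapsto u_z$, where $u_z(x,x')=(x,m_z^{\mathsf T}(x'))$. The restriction of $\mathfrak{Jac}(A)$ to a class in $H^1(B^\times\cap Z(B),A^\times)$ is trivial if and only if the group $B^\times\cap Z(B)$ is itself trivial.
   Context: Algebras are associative and unital over $\Bbbk$. $D(B)=\mathrm{Hom}_\Bbbk(B,\Bbbk)$ is a $B$-bimodule via $(x\lambda y)(b)=\lambda(ybx)$. The trivial extension is $A=B\oplus D(B)$ with product $(x,x')(y,y')=(xy,xy'+x'y)$; the bilinear form $\langle(x,x'),(y,y')\rangle=x'(y)+y'(x)$ on $A$ is non-degenerate, associative and symmetric. For $z\in Z(B)$ (the center of $B$), $m_z:B\to B$ is $x\mapsto zx$ and $m_z^{\mathsf T}:D(B)\to D(B)$ is its transpose, $m_z^{\mathsf T}(\lambda)=\lambda\circ m_z$. The Nakayama Jacobian $\mathrm{jac}_\sigma(u)$ of an algebra automorphism $u:A\to A$ is the unique element of $A$ with $\langle u(a),u(b)\rangle=\langle\mathrm{jac}_\sigma(u)\cdot a,b\rangle$ for all $a,b\in A$; it is a unit. Non-abelian cohomology: for a group $G$ acting on a group $M$ by automorphisms, a $1$-cocycle is a function $f:G\to M$ with $f(gh)=f(g)\cdot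 g(f(h))$; cocycles $f,f'$ are cohomologous if there is $\xi\in M$ with $f'(g)=\xi^{-1}f(g)\,g(\xi)$ for all $g$; $H^1(G,M)$ is the pointed set of classes, with trivial element the class of the constant cocycle $1$. $\mathrm{Aut}(A)$, the group of algebra automorphisms, acts on the group of units $A^\times$ by evaluation, and $\mathfrak{Jac}(A)$ is the class of the $1$-cocycle $u\mapsto\mathrm{jac}_\sigma(u^{-1})$. *)

theory Defs
  imports
    "HOL-Algebra.Bij"
    "HOL-Algebra.Elementary_Groups"
    "Jordan_Normal_Form.Missing_VectorSpace"
begin

section \<open>Associative unital algebras over a field\<close>

text \<open>The library locale \<^locale>\<open>algebra\<close> requires commutativity, hence a separate locale.
  The zero algebra is allowed.\<close>

locale assoc_algebra = vectorspace K B + B: ring B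
  for K :: "('k, 'c) ring_scheme" and B :: "('k, 'b, 'd) module_scheme" +
  assumes smult_mult_left: "\<lbrakk>c \<in> carrier K; x \<in> carrier B; y \<in> carrier B\<rbrakk> \<Longrightarrow>
      (c \<odot>\<^bsub>B\<^esub> x) \<otimes>\<^bsub>B\<^esub> y = c \<odot>\<^bsub>B\<^esub> (x \<otimes>\<^bsub>B\<^esub> y)"
    and smult_mult_right: "\<lbrakk>c \<in> carrier K; x \<in> carrier B; y \<in> carrier B\<rbrakk> \<Longrightarrow>
      x \<otimes>\<^bsub>B\<^esub> (c \<odot>\<^bsub>B\<^esub> y) = c \<odot>\<^bsub>B\<^esub> (x \<otimes>\<^bsub>B\<^esub> y)"

definition ring_center :: "('b, 'd) ring_scheme \<Rightarrow> 'b set" where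
  "ring_center B = {z \<in> carrier B. \<forall>x \<in> carrier B. z \<otimes>\<^bsub>B\<^esub> x = x \<otimes>\<^bsub>B\<^esub> z}"

definition central_units :: "('b, 'd) ring_scheme \<Rightarrow> 'b monoid" where
  "central_units B = (units_of B)\<lparr>carrier := Units B \<inter> ring_center B\<rparr>"

text \<open>As for \<^const>\<open>AutoGroup\<close>, automorphisms are extensional on the carrier and the group law is
  composition, \<open>(u v)(a) = u (v a)\<close>.\<close>

definition alg_autos :: "('k, 'c) ring_scheme \<Rightarrow> ('k, 'a, 'd) module_scheme \<Rightarrow> ('a \<Rightarrow> 'a) set" where
  "alg_autos K A = {u \<in> Bij (carrier A). u \<in> ring_hom A A \<and>
     (\<forall>c \<in> carrier K. \<forall>a \<in> carrier A. u (c \<odot>\<^bsub>A\<^esub> a) = c \<odot>\<^bsub>A\<^esub> u a)}"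

definition Alg_Aut :: "('k, 'c) ring_scheme \<Rightarrow> ('k, 'a, 'd) module_scheme \<Rightarrow> ('a \<Rightarrow> 'a) monoid" where
  "Alg_Aut K A = (BijGroup (carrier A))\<lparr>carrier := alg_autos K A\<rparr>"

definition eval_units :: "('a, 'd) ring_scheme \<Rightarrow> ('a \<Rightarrow> 'a) \<Rightarrow> 'a \<Rightarrow> 'a" where
  "eval_units A u = restrict u (Units A)"


section \<open>The trivial extension\<close>

text \<open>\<open>D(B)\<close>: linear forms, made extensional so that equal forms are equal functions.\<close>

definition dual_space :: "('k, 'c) ring_scheme \<Rightarrow> ('k, 'b, 'd) module_scheme \<Rightarrow> ('b \<Rightarrow> 'k) set" where
  "dual_space K B = {l \<in> carrier B \<rightarrow>\<^sub>E carrier K.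
     (\<forall>x \<in> carrier B. \<forall>y \<in> carrier B. l (x \<oplus>\<^bsub>B\<^esub> y) = l x \<oplus>\<^bsub>K\<^esub> l y) \<and>
     (\<forall>c \<in> carrier K. \<forall>x \<in> carrier B. l (c \<odot>\<^bsub>B\<^esub> x) = c \<otimes>\<^bsub>K\<^esub> l x)}"

definition dual_zero :: "('k, 'c) ring_scheme \<Rightarrow> ('k, 'b, 'd) module_scheme \<Rightarrow> 'b \<Rightarrow> 'k" where
  "dual_zero K B = (\<lambda>b \<in> carrier B. \<zero>\<^bsub>K\<^esub>)"

definition dual_add ::
  "('k, 'c) ring_scheme \<Rightarrow> ('k, 'b, 'd) module_scheme \<Rightarrow> ('b \<Rightarrow> 'k) \<Rightarrow> ('b \<Rightarrow> 'k) \<Rightarrow> 'b \<Rightarrow> 'k" where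
  "dual_add K B l m = (\<lambda>b \<in> carrier B. l b \<oplus>\<^bsub>K\<^esub> m b)"

definition dual_smult ::
  "('k, 'c) ring_scheme \<Rightarrow> ('k, 'b, 'd) module_scheme \<Rightarrow> 'k \<Rightarrow> ('b \<Rightarrow> 'k) \<Rightarrow> 'b \<Rightarrow> 'k" where
  "dual_smult K B c l = (\<lambda>b \<in> carrier B. c \<otimes>\<^bsub>K\<^esub> l b)"

definition dual_bimod :: "('k, 'b, 'd) module_scheme \<Rightarrow> 'b \<Rightarrow> ('b \<Rightarrow> 'k) \<Rightarrow> 'b \<Rightarrow> 'b \<Rightarrow> 'k" where
  "dual_bimod B x l y = (\<lambda>b \<in> carrier B. l (y \<otimes>\<^bsub>B\<^esub> b \<otimes>\<^bsub>B\<^esub> x))"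

definition trivial_extension ::
  "('k, 'c) ring_scheme \<Rightarrow> ('k, 'b, 'd) module_scheme \<Rightarrow> ('k, 'b \<times> ('b \<Rightarrow> 'k)) module" where
  "trivial_extension K B =
    \<lparr>carrier = carrier B \<times> dual_space K B,
     monoid.mult = (\<lambda>(x, x') (y, y').
       (x \<otimes>\<^bsub>B\<^esub> y, dual_add K B (dual_bimod B x y' \<one>\<^bsub>B\<^esub>) (dual_bimod B \<one>\<^bsub>B\<^esub> x' y))),
     one = (\<one>\<^bsub>B\<^esub>, dual_zero K B),
     zero = (\<zero>\<^bsub>B\<^esub>, dual_zero K B),
     add = (\<lambda>(x, x') (y, y'). (x \<oplus>\<^bsub>B\<^esub> y, dual_add K B x' y')),
     smult = (\<lambda>c (x, x'). (c \<odot>\<^bsub>B\<^esub> x, dual_smult K B c x'))\<rparr>"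

definition trivext_form ::
  "('k, 'c) ring_scheme \<Rightarrow> 'b \<times> ('b \<Rightarrow> 'k) \<Rightarrow> 'b \<times> ('b \<Rightarrow> 'k) \<Rightarrow> 'k" where
  "trivext_form K = (\<lambda>(x, x') (y, y'). x' y \<oplus>\<^bsub>K\<^esub> y' x)"

definition mult_map :: "('b, 'd) ring_scheme \<Rightarrow> 'b \<Rightarrow> 'b \<Rightarrow> 'b" where
  "mult_map B z = (\<lambda>x \<in> carrier B. z \<otimes>\<^bsub>B\<^esub> x)"

definition transpose_map :: "('b, 'd) ring_scheme \<Rightarrow> ('b \<Rightarrow> 'b) \<Rightarrow> ('b \<Rightarrow> 'k) \<Rightarrow> 'b \<Rightarrow> 'k" where
  "transpose_map B f l = compose (carrier B) l f"

text \<open>The automorphism \<open>u\<^sub>z\<close>.\<close>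

definition central_unit_aut ::
  "('k, 'c) ring_scheme \<Rightarrow> ('k, 'b, 'd) module_scheme \<Rightarrow> 'b \<Rightarrow>
    'b \<times> ('b \<Rightarrow> 'k) \<Rightarrow> 'b \<times> ('b \<Rightarrow> 'k)" where
  "central_unit_aut K B z =
    (\<lambda>(x, x') \<in> carrier (trivial_extension K B). (x, transpose_map B (mult_map B z) x'))"


section \<open>Non-abelian first cohomology\<close>

text \<open>\<open>\<phi> g\<close> is the automorphism of \<open>M\<close> by which \<open>g\<close> acts. Elements of \<open>H\<^sup>1\<close> are equivalence
  classes of cocycles, and cocycles are extensional on the carrier of \<open>G\<close>.\<close>

definition cocycles ::
  "('g, 'c) monoid_scheme \<Rightarrow> ('m, 'd) monoid_scheme \<Rightarrow> ('g \<Rightarrow> 'm \<Rightarrow> 'm) \<Rightarrow> ('g \<Rightarrow> 'm) set" where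
  "cocycles G M \<phi> = {f \<in> carrier G \<rightarrow>\<^sub>E carrier M.
     \<forall>g \<in> carrier G. \<forall>h \<in> carrier G. f (g \<otimes>\<^bsub>G\<^esub> h) = f g \<otimes>\<^bsub>M\<^esub> \<phi> g (f h)}"

definition cohomologous ::
  "('g, 'c) monoid_scheme \<Rightarrow> ('m, 'd) monoid_scheme \<Rightarrow> ('g \<Rightarrow> 'm \<Rightarrow> 'm) \<Rightarrow> ('g \<Rightarrow> 'm) rel" where
  "cohomologous G M \<phi> = {(f, f'). f \<in> cocycles G M \<phi> \<and> f' \<in> cocycles G M \<phi> \<and>
     (\<exists>\<xi> \<in> carrier M. \<forall>g \<in> carrier G. f' g = inv\<^bsub>M\<^esub> \<xi> \<otimes>\<^bsub>M\<^esub> f g \<otimes>\<^bsub>M\<^esub> \<phi> g \<xi>)}"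

definition H1 ::
  "('g, 'c) monoid_scheme \<Rightarrow> ('m, 'd) monoid_scheme \<Rightarrow> ('g \<Rightarrow> 'm \<Rightarrow> 'm) \<Rightarrow> ('g \<Rightarrow> 'm) set set" where
  "H1 G M \<phi> = cocycles G M \<phi> // cohomologous G M \<phi>"

definition H1_class ::
  "('g, 'c) monoid_scheme \<Rightarrow> ('m, 'd) monoid_scheme \<Rightarrow> ('g \<Rightarrow> 'm \<Rightarrow> 'm) \<Rightarrow> ('g \<Rightarrow> 'm) \<Rightarrow> ('g \<Rightarrow> 'm) set"
where
  "H1_class G M \<phi> f = cohomologous G M \<phi> `` {f}"

lemma H1_class_in_H1: "f \<in> cocycles G M \<phi> \<Longrightarrow> H1_class G M \<phi> f \<in> H1 G M \<phi>"
  by (simp add: H1_class_def H1_def quotientI)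

definition H1_trivial ::
  "('g, 'c) monoid_scheme \<Rightarrow> ('m, 'd) monoid_scheme \<Rightarrow> ('g \<Rightarrow> 'm \<Rightarrow> 'm) \<Rightarrow> ('g \<Rightarrow> 'm) set" where
  "H1_trivial G M \<phi> = H1_class G M \<phi> (\<lambda>g \<in> carrier G. \<one>\<^bsub>M\<^esub>)"

text \<open>Restriction \<open>H\<^sup>1(G, M) \<rightarrow> H\<^sup>1(H, M)\<close> along a homomorphism \<open>\<iota> : H \<rightarrow> G\<close>, with \<open>H\<close> acting
  through \<open>\<iota>\<close>: the class of \<open>f \<circ> \<iota>\<close> for any representative \<open>f\<close>.\<close>

definition H1_res ::
  "('h, 'c) monoid_scheme \<Rightarrow> ('m, 'd) monoid_scheme \<Rightarrow> ('g \<Rightarrow> 'm \<Rightarrow> 'm) \<Rightarrow> ('h \<Rightarrow> 'g) \<Rightarrow>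
    ('g \<Rightarrow> 'm) set \<Rightarrow> ('h \<Rightarrow> 'm) set" where
  "H1_res H M \<phi> \<iota> C = (\<Union>f \<in> C. H1_class H M (\<phi> \<circ> \<iota>) (compose (carrier H) f \<iota>))"


section \<open>The Nakayama Jacobian\<close>

definition nakayama_jac ::
  "('a, 'd) ring_scheme \<Rightarrow> ('a \<Rightarrow> 'a \<Rightarrow> 'k) \<Rightarrow> ('a \<Rightarrow> 'a) \<Rightarrow> 'a" where
  "nakayama_jac A form u = (THE j. j \<in> carrier A \<and>
     (\<forall>a \<in> carrier A. \<forall>b \<in> carrier A. form (u a) (u b) = form (j \<otimes>\<^bsub>A\<^esub> a) b))"

definition Jac_class ::
  "('k, 'c) ring_scheme \<Rightarrow> ('k, 'a, 'd) module_scheme \<Rightarrow> ('a \<Rightarrow> 'a \<Rightarrow> 'k) \<Rightarrow> (('a \<Rightarrow> 'a) \<Rightarrow> 'a) set"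
where
  "Jac_class K A form = H1_class (Alg_Aut K A) (units_of A) (eval_units A)
     (\<lambda>u \<in> carrier (Alg_Aut K A). nakayama_jac A form (inv\<^bsub>Alg_Aut K A\<^esub> u))"

end

theory Submission
  imports Defs
begin

text \<open>For a central unit \<open>z\<close> one computes \<open>jac(u\<^sub>z) = (z, 0)\<close>, so the restricted cocycle is
  \<open>z \<mapsto> (z\<^sup>-\<^sup>1, 0)\<close>. Every \<open>u\<^sub>z\<close> fixes the first component of \<open>A\<close>, so on first components a change of
  representative is a conjugation; if the class is trivial, \<open>z\<^sup>-\<^sup>1\<close> is conjugate to \<open>1\<close>, whence
  \<open>z = 1\<close>. Conversely a cocycle on the trivial group is constantly \<open>1\<close>. What remains is that the
  Jacobian class is not empty, that is, that \<open>u \<mapsto> jac(u\<^sup>-\<^sup>1)\<close> is a cocycle on all of \<open>Aut(A)\<close>: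
  the Jacobian exists because the form represents every functional on \<open>A\<close>, which for
  \<open>B \<oplus> D(B)\<close> is the reflexivity of \<open>B\<close>.\<close>

section \<open>Duals of finite-dimensional vector spaces\<close>

context vectorspace
begin

section \<open>Linear forms as extensional functions\<close>

lemma dual_space_closed: "\<lbrakk>l \<in> dual_space K V; x \<in> carrier V\<rbrakk> \<Longrightarrow> l x \<in> carrier K"
  by (auto simp: dual_space_def)

lemma dual_space_add:
  "\<lbrakk>l \<in> dual_space K V; x \<in> carrier V; y \<in> carrier V\<rbrakk> \<Longrightarrow> l (x \<oplus>\<^bsub>V\<^esub> y) = l x \<oplus>\<^bsub>K\<^esub> l y"
  by (simp add: dual_space_def)

lemma dual_space_smult:
  "\<lbrakk>l \<in> dual_space K V; c \<in> carrier K; x \<in> carrier V\<rbrakk> \<Longrightarrow> l (c \<odot>\<^bsub>V\<^esub> x) = c \<otimes>\<^bsub>K\<^esub> l x"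
  by (simp add: dual_space_def)

lemma dual_space_zero: "l \<in> dual_space K V \<Longrightarrow> l \<zero>\<^bsub>V\<^esub> = \<zero>\<^bsub>K\<^esub>"
  using dual_space_smult[of l "\<zero>\<^bsub>K\<^esub>" "\<zero>\<^bsub>V\<^esub>"] by (simp add: dual_space_closed)

lemma dual_space_ext:
  assumes "l \<in> dual_space K V" "m \<in> dual_space K V" "\<And>x. x \<in> carrier V \<Longrightarrow> l x = m x"
  shows "l = m"
proof (rule extensionalityI[where A = "carrier V"])
qed (use assms in \<open>auto simp: dual_space_def PiE_def\<close>)

lemma dual_spaceI:
  assumes "l \<in> extensional (carrier V)" "\<And>x. x \<in> carrier V \<Longrightarrow> l x \<in> carrier K"
    "\<And>x y. \<lbrakk>x \<in> carrier V; y \<in> carrier V\<rbrakk> \<Longrightarrow> l (x \<oplus>\<^bsub>V\<^esub> y) = l x \<oplus>\<^bsub>K\<^esub> l y"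
    "\<And>c x. \<lbrakk>c \<in> carrier K; x \<in> carrier V\<rbrakk> \<Longrightarrow> l (c \<odot>\<^bsub>V\<^esub> x) = c \<otimes>\<^bsub>K\<^esub> l x"
  shows "l \<in> dual_space K V"
  using assms by (auto simp: dual_space_def PiE_def)

lemma dual_zero_closed: "dual_zero K V \<in> dual_space K V"
  by (rule dual_spaceI) (auto simp: dual_zero_def)

lemma dual_add_closed:
  "\<lbrakk>l \<in> dual_space K V; m \<in> dual_space K V\<rbrakk> \<Longrightarrow> dual_add K V l m \<in> dual_space K V"
  by (rule dual_spaceI)
    (auto simp: dual_add_def dual_space_closed dual_space_add dual_space_smult R.r_distr R.a_ac)

lemma dual_smult_closed:
  "\<lbrakk>c \<in> carrier K; l \<in> dual_space K V\<rbrakk> \<Longrightarrow> dual_smult K V c l \<in> dual_space K V"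
  by (rule dual_spaceI)
    (auto simp: dual_smult_def dual_space_closed dual_space_add dual_space_smult R.r_distr R.m_ac)

lemma dual_add_apply: "x \<in> carrier V \<Longrightarrow> dual_add K V l m x = l x \<oplus>\<^bsub>K\<^esub> m x"
  by (simp add: dual_add_def)

lemma dual_smult_apply: "x \<in> carrier V \<Longrightarrow> dual_smult K V c l x = c \<otimes>\<^bsub>K\<^esub> l x"
  by (simp add: dual_smult_def)

lemma dual_zero_apply: "x \<in> carrier V \<Longrightarrow> dual_zero K V x = \<zero>\<^bsub>K\<^esub>"
  by (simp add: dual_zero_def)

lemma dual_space_lincomb:
  assumes l: "l \<in> dual_space K V"
    and "finite S" "S \<subseteq> carrier V" "a \<in> S \<rightarrow> carrier K"
  shows "l (lincomb a S) = (\<Oplus>\<^bsub>K\<^esub>s\<in>S. a s \<otimes>\<^bsub>K\<^esub> l s)"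
  using assms(2-)
proof (induction S rule: finite_induct)
  case empty
  then show ?case by (simp add: lincomb_def dual_space_zero[OF l])
next
  case (insert s S)
  have "l (lincomb a (insert s S)) = l (a s \<odot>\<^bsub>V\<^esub> s \<oplus>\<^bsub>V\<^esub> lincomb a S)"
    using insert.prems insert.hyps lincomb_insert2[of S a s] by simp
  also have "\<dots> = a s \<otimes>\<^bsub>K\<^esub> l s \<oplus>\<^bsub>K\<^esub> l (lincomb a S)"
    using insert.prems by (simp add: dual_space_add[OF l] dual_space_smult[OF l])
  also have "\<dots> = (\<Oplus>\<^bsub>K\<^esub>t\<in>insert s S. a t \<otimes>\<^bsub>K\<^esub> l t)"
    using insert by (subst R.finsum_insert) (auto simp: dual_space_closed[OF l] subset_iff Pi_iff)
  finally show ?case .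
qed

section \<open>Dual bases, separation of points and reflexivity\<close>

text \<open>Coordinates in a finite basis are unique, hence linear in the vector. What is exported
  is the expansion of a vector by its coordinate forms.\<close>

lemma dual_basis_exists:
  assumes fin_dim
  obtains S e where "finite S" "S \<subseteq> carrier V" "\<And>s. s \<in> S \<Longrightarrow> e s \<in> dual_space K V"
    "\<And>x. x \<in> carrier V \<Longrightarrow> lincomb (\<lambda>s. e s x) S = x"
proof -
  obtain S where fin: "finite S" and S: "basis S"
    using finite_basis_exists[OF assms] by blast
  have SV: "S \<subseteq> carrier V"
    using S by (simp add: basis_def)
  have uniq: "\<exists>!a. a \<in> S \<rightarrow>\<^sub>E carrier K \<and> lincomb a S = x" if "x \<in> carrier V" for x
    using basis_criterion[OF fin SV] S that by blast
  \<comment> \<open>The coordinate function of \<open>x\<close>, taken extensional on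
    \<open>S\<close> so that it is unique as a function.\<close>
  define co where "co x = (THE a. a \<in> S \<rightarrow>\<^sub>E carrier K \<and> lincomb a S = x)" for x
  have co: "co x \<in> S \<rightarrow>\<^sub>E carrier K \<and> lincomb (co x) S = x" if "x \<in> carrier V" for x
    unfolding co_def by (rule theI'[OF uniq[OF that]])
  \<comment> \<open>Coordinates can be read off from any representation of \<open>x\<close>,
    whatever its coefficients do outside \<open>S\<close>. Linearity of \<open>e s\<close> then only
    needs some combination that represents the sum or the multiple.\<close>
  have co_eq: "co x s = a s" if "a \<in> S \<rightarrow> carrier K" "lincomb a S = x" "s \<in> S" for a x s
  proof -
    have "x \<in> carrier V"
      using lincomb_closed[OF SV that(1)] that(2) by simp
    moreover have "restrict a S \<in> S \<rightarrow>\<^sub>E carrier K \<and> lincomb (restrict a S) S = x"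
      using that lincomb_cong[OF refl SV, of "restrict a S" a] by auto
    ultimately have "co x = restrict a S"
      using uniq co by blast
    then show ?thesis using that by simp
  qed
  define e where "e s = (\<lambda>x \<in> carrier V. co x s)" for s
  show thesis
  proof (rule that[OF fin SV, of e])
    fix s assume s: "s \<in> S"
    show "e s \<in> dual_space K V"
    proof (rule dual_spaceI)
      fix x y assume "x \<in> carrier V" "y \<in> carrier V"
      then show "e s (x \<oplus>\<^bsub>V\<^esub> y) = e s x \<oplus>\<^bsub>K\<^esub> e s y"
        using co[of x] co[of y] s lincomb_sum[OF fin SV, of "co x" "co y"]
        by (auto simp: e_def PiE_def Pi_iff intro!: co_eq)
    next
      fix c x assume "c \<in> carrier K" "x \<in> carrier V"
      then show "e s (c \<odot>\<^bsub>V\<^esub> x) = c \<otimes>\<^bsub>K\<^esub> e s x"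
        using co[of x] s lincomb_smult[OF SV, of "co x" c]
        by (auto simp: e_def PiE_def Pi_iff intro!: co_eq)
    qed (use s co in \<open>auto simp: e_def\<close>)
  next
    fix x assume x: "x \<in> carrier V"
    then show "lincomb (\<lambda>s. e s x) S = x"
      using co[OF x] lincomb_cong[OF refl SV, of "\<lambda>s. e s x" "co x"] by (auto simp: e_def)
  qed
qed

text \<open>A vector is rebuilt from the values of the coordinate forms at it, so these finitely
  many forms already separate points.\<close>

lemma dual_separates_points:
  assumes fin_dim "x \<in> carrier V" "y \<in> carrier V"
    and eq: "\<And>l. l \<in> dual_space K V \<Longrightarrow> l x = l y"
  shows "x = y"
proof -
  obtain S e where S: "finite S" "S \<subseteq> carrier V" "\<And>s. s \<in> S \<Longrightarrow> e s \<in> dual_space K V"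
    and e: "\<And>x. x \<in> carrier V \<Longrightarrow> lincomb (\<lambda>s. e s x) S = x"
    using dual_basis_exists[OF \<open>fin_dim\<close>] by blast
  have "lincomb (\<lambda>s. e s x) S = lincomb (\<lambda>s. e s y) S"
    using S assms by (intro lincomb_cong) (auto simp: dual_space_closed)
  then show ?thesis using e assms by simp
qed

text \<open>Expanding \<open>l\<close> as the sum of the \<open>l s\<close> times \<open>e s\<close>
  gives \<open>\<Phi> l\<close> as the sum of the \<open>l s\<close> times
  \<open>\<Phi> (e s)\<close>. This is the value of \<open>l\<close> at the vector with coefficients
  \<open>\<Phi> (e s)\<close>.\<close>

lemma dual_reflexive:
  assumes fin_dim
    and closed: "\<And>l. l \<in> dual_space K V \<Longrightarrow> \<Phi> l \<in> carrier K"
    and add: "\<And>l m. \<lbrakk>l \<in> dual_space K V; m \<in> dual_space K V\<rbrakk> \<Longrightarrow>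
      \<Phi> (dual_add K V l m) = \<Phi> l \<oplus>\<^bsub>K\<^esub> \<Phi> m"
    and smult: "\<And>c l. \<lbrakk>c \<in> carrier K; l \<in> dual_space K V\<rbrakk> \<Longrightarrow>
      \<Phi> (dual_smult K V c l) = c \<otimes>\<^bsub>K\<^esub> \<Phi> l"
  obtains x where "x \<in> carrier V" "\<And>l. l \<in> dual_space K V \<Longrightarrow> \<Phi> l = l x"
proof -
  obtain S e where S: "finite S" "S \<subseteq> carrier V" "\<And>s. s \<in> S \<Longrightarrow> e s \<in> dual_space K V"
    and e: "\<And>x. x \<in> carrier V \<Longrightarrow> lincomb (\<lambda>s. e s x) S = x"
    using dual_basis_exists[OF \<open>fin_dim\<close>] by blast
  have ex: "e s x \<in> carrier K" if "s \<in> S" "x \<in> carrier V" for s x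
    using that S by (simp add: dual_space_closed)
  define x where "x = lincomb (\<lambda>s. \<Phi> (e s)) S"
  have \<Phi>e: "(\<lambda>s. \<Phi> (e s)) \<in> S \<rightarrow> carrier K"
    using S closed by auto
  show thesis
  proof (rule that)
    show "x \<in> carrier V"
      using S \<Phi>e by (simp add: x_def)
  next
    fix l assume l: "l \<in> dual_space K V"
    have lS: "l s \<in> carrier K" if "s \<in> S" for s
      using that S l by (auto simp: dual_space_closed)
    \<comment> \<open>Partial sums of the expansion of \<open>l\<close> in the forms
      \<open>e s\<close>, formed pointwise. The induction carries membership in
      \<open>dual_space K V\<close> along, because \<open>\<Phi>\<close> is assumed linear only
      there.\<close>
    define p where "p T = (\<lambda>y \<in> carrier V. \<Oplus>\<^bsub>K\<^esub>s\<in>T. l s \<otimes>\<^bsub>K\<^esub> e s y)" for T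
    have p: "p T \<in> dual_space K V \<and> \<Phi> (p T) = (\<Oplus>\<^bsub>K\<^esub>s\<in>T. \<Phi> (e s) \<otimes>\<^bsub>K\<^esub> l s)"
      if "finite T" "T \<subseteq> S" for T
      using that
    proof (induction T rule: finite_induct)
      case empty
      \<comment> \<open>Writing the zero form as a multiple by zero lets homogeneity show that
        \<open>\<Phi>\<close> vanishes on it.\<close>
      have "dual_zero K V = dual_smult K V \<zero>\<^bsub>K\<^esub> (dual_zero K V)"
        by (auto simp: dual_zero_def dual_smult_def)
      then have "\<Phi> (dual_zero K V) = \<zero>\<^bsub>K\<^esub>"
        using smult[of "\<zero>\<^bsub>K\<^esub>" "dual_zero K V"] closed dual_zero_closed by simp
      moreover have "p {} = dual_zero K V"
        by (simp add: p_def dual_zero_def)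
      ultimately show ?case
        using dual_zero_closed by simp
    next
      case (insert s T)
      have s: "s \<in> S" "e s \<in> dual_space K V" "l s \<in> carrier K" and T: "T \<subseteq> S"
        using insert.prems S lS by auto
      have p_insert: "p (insert s T) = dual_add K V (dual_smult K V (l s) (e s)) (p T)"
        unfolding p_def dual_add_def
      proof (rule restrict_ext)
        fix y assume "y \<in> carrier V"
        then show "(\<Oplus>\<^bsub>K\<^esub>t\<in>insert s T. l t \<otimes>\<^bsub>K\<^esub> e t y) = dual_smult K V (l s) (e s) y \<oplus>\<^bsub>K\<^esub>
            (\<lambda>y \<in> carrier V. \<Oplus>\<^bsub>K\<^esub>t\<in>T. l t \<otimes>\<^bsub>K\<^esub> e t y) y"
          using insert.hyps s T ex lS
          by (subst R.finsum_insert) (auto simp: dual_smult_apply subset_iff)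
      qed
      have "(\<Oplus>\<^bsub>K\<^esub>t\<in>insert s T. \<Phi> (e t) \<otimes>\<^bsub>K\<^esub> l t) =
          \<Phi> (e s) \<otimes>\<^bsub>K\<^esub> l s \<oplus>\<^bsub>K\<^esub> (\<Oplus>\<^bsub>K\<^esub>t\<in>T. \<Phi> (e t) \<otimes>\<^bsub>K\<^esub> l t)"
        using insert.hyps s T S closed lS by (intro R.finsum_insert) (auto simp: subset_iff)
      then show ?case
        using insert.IH[OF T] s closed
        by (simp add: p_insert add smult dual_add_closed dual_smult_closed R.m_comm)
    qed
    \<comment> \<open>The full sum recovers \<open>l\<close>: apply \<open>l\<close> to the
      expansion of \<open>y\<close> over \<open>S\<close>.\<close>
    have "p S = l"
    proof (rule dual_space_ext)
      show "p S \<in> dual_space K V" using p[OF S(1)] by simp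
      fix y assume y: "y \<in> carrier V"
      have "l y = l (lincomb (\<lambda>s. e s y) S)" using e[OF y] by simp
      also have "\<dots> = (\<Oplus>\<^bsub>K\<^esub>s\<in>S. e s y \<otimes>\<^bsub>K\<^esub> l s)"
        using S y ex by (intro dual_space_lincomb l) auto
      also have "\<dots> = p S y"
        using y ex lS by (auto simp: p_def R.m_comm intro!: R.finsum_cong')
      finally show "p S y = l y" ..
    qed (fact l)
    then show "\<Phi> l = l x"
      using p[OF S(1)] dual_space_lincomb[OF l S(1,2) \<Phi>e] by (simp add: x_def)
  qed
qed

end

section \<open>Cocycles\<close>

text \<open>The witness is \<open>\<xi> = 1\<close>. This puts a cocycle into its own class, which
  is how classes are seen to be nonempty.\<close>

lemma cohomologous_refl:
  assumes "group M" "f \<in> cocycles G M \<phi>" "\<And>g. g \<in> carrier G \<Longrightarrow> \<phi> g \<one>\<^bsub>M\<^esub> = \<one>\<^bsub>M\<^esub>"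
  shows "(f, f) \<in> cohomologous G M \<phi>"
proof -
  interpret M: group M by fact
  have "\<forall>g\<in>carrier G. f g = inv\<^bsub>M\<^esub> \<one>\<^bsub>M\<^esub> \<otimes>\<^bsub>M\<^esub> f g \<otimes>\<^bsub>M\<^esub> \<phi> g \<one>\<^bsub>M\<^esub>"
    using assms(2,3) by (auto simp: cocycles_def PiE_def Pi_iff)
  then show ?thesis
    using assms(2) M.one_closed unfolding cohomologous_def by blast
qed

lemma trivial_cocycle:
  assumes "group G" "group M" "\<And>g. g \<in> carrier G \<Longrightarrow> \<phi> g \<one>\<^bsub>M\<^esub> = \<one>\<^bsub>M\<^esub>"
  shows "(\<lambda>g \<in> carrier G. \<one>\<^bsub>M\<^esub>) \<in> cocycles G M \<phi>"
proof -
  interpret G: group G by fact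
  interpret M: group M by fact
  show ?thesis using assms(3) by (auto simp: cocycles_def)
qed

text \<open>Since the neutral element acts as the identity, the cocycle law at (1, 1) makes
  \<open>f 1\<close> idempotent in the group \<open>M\<close>, and one factor cancels.\<close>

lemma cocycle_one:
  assumes "group G" "group M" "f \<in> cocycles G M \<phi>"
    and "\<And>m. m \<in> carrier M \<Longrightarrow> \<phi> \<one>\<^bsub>G\<^esub> m = m"
  shows "f \<one>\<^bsub>G\<^esub> = \<one>\<^bsub>M\<^esub>"
proof -
  interpret G: group G by fact
  interpret M: group M by fact
  have f: "f \<one>\<^bsub>G\<^esub> \<in> carrier M"
    using assms(3) by (auto simp: cocycles_def)
  have "f (\<one>\<^bsub>G\<^esub> \<otimes>\<^bsub>G\<^esub> \<one>\<^bsub>G\<^esub>) = f \<one>\<^bsub>G\<^esub> \<otimes>\<^bsub>M\<^esub> \<phi> \<one>\<^bsub>G\<^esub> (f \<one>\<^bsub>G\<^esub>)"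
    using assms(3) G.one_closed unfolding cocycles_def by blast
  then show ?thesis
    using f assms(4) by (simp add: M.r_cancel_one)
qed

section \<open>The Jacobian cocycle of a Frobenius form\<close>

text \<open>What the Jacobian calculus takes from a Frobenius algebra.
  \<open>form_nondegenerate\<close> says that \<open>a\<close> is determined by the functional
  \<open>form a\<close>; \<open>form_represents\<close> says that every linear functional has this
  shape, and stands in for finite dimension of \<open>A\<close>.\<close>

locale frobenius_form = monoid A
  for K :: "('k, 'c) ring_scheme" and A :: "('k, 'a, 'd) module_scheme"
    and form :: "'a \<Rightarrow> 'a \<Rightarrow> 'k" +
  assumes add_closed: "\<lbrakk>a \<in> carrier A; b \<in> carrier A\<rbrakk> \<Longrightarrow> a \<oplus>\<^bsub>A\<^esub> b \<in> carrier A"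
    and scale_closed: "\<lbrakk>c \<in> carrier K; a \<in> carrier A\<rbrakk> \<Longrightarrow> c \<odot>\<^bsub>A\<^esub> a \<in> carrier A"
    and form_closed: "\<lbrakk>a \<in> carrier A; b \<in> carrier A\<rbrakk> \<Longrightarrow> form a b \<in> carrier K"
    and form_add: "\<lbrakk>a \<in> carrier A; b \<in> carrier A; b' \<in> carrier A\<rbrakk> \<Longrightarrow>
      form a (b \<oplus>\<^bsub>A\<^esub> b') = form a b \<oplus>\<^bsub>K\<^esub> form a b'"
    and form_smult: "\<lbrakk>c \<in> carrier K; a \<in> carrier A; b \<in> carrier A\<rbrakk> \<Longrightarrow>
      form a (c \<odot>\<^bsub>A\<^esub> b) = c \<otimes>\<^bsub>K\<^esub> form a b"
    and form_assoc: "\<lbrakk>a \<in> carrier A; b \<in> carrier A; b' \<in> carrier A\<rbrakk> \<Longrightarrow>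
      form (a \<otimes>\<^bsub>A\<^esub> b) b' = form a (b \<otimes>\<^bsub>A\<^esub> b')"
    and form_nondegenerate: "\<lbrakk>a \<in> carrier A; a' \<in> carrier A;
      \<And>b. b \<in> carrier A \<Longrightarrow> form a b = form a' b\<rbrakk> \<Longrightarrow> a = a'"
    and form_represents: "\<lbrakk>\<And>a. a \<in> carrier A \<Longrightarrow> F a \<in> carrier K;
      \<And>a b. \<lbrakk>a \<in> carrier A; b \<in> carrier A\<rbrakk> \<Longrightarrow> F (a \<oplus>\<^bsub>A\<^esub> b) = F a \<oplus>\<^bsub>K\<^esub> F b;
      \<And>c a. \<lbrakk>c \<in> carrier K; a \<in> carrier A\<rbrakk> \<Longrightarrow> F (c \<odot>\<^bsub>A\<^esub> a) = c \<otimes>\<^bsub>K\<^esub> F a\<rbrakk> \<Longrightarrow>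
      \<exists>j \<in> carrier A. \<forall>a \<in> carrier A. F a = form j a"
begin

section \<open>The group of algebra automorphisms\<close>

lemma alg_autosD:
  assumes "u \<in> alg_autos K A"
  shows alg_aut_Bij: "u \<in> Bij (carrier A)"
    and alg_aut_one: "u \<one>\<^bsub>A\<^esub> = \<one>\<^bsub>A\<^esub>"
    and alg_aut_closed: "\<And>a. a \<in> carrier A \<Longrightarrow> u a \<in> carrier A"
    and alg_aut_mult: "\<And>a b. \<lbrakk>a \<in> carrier A; b \<in> carrier A\<rbrakk> \<Longrightarrow> u (a \<otimes>\<^bsub>A\<^esub> b) = u a \<otimes>\<^bsub>A\<^esub> u b"
    and alg_aut_add: "\<And>a b. \<lbrakk>a \<in> carrier A; b \<in> carrier A\<rbrakk> \<Longrightarrow> u (a \<oplus>\<^bsub>A\<^esub> b) = u a \<oplus>\<^bsub>A\<^esub> u b"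
    and alg_aut_smult: "\<And>c a. \<lbrakk>c \<in> carrier K; a \<in> carrier A\<rbrakk> \<Longrightarrow> u (c \<odot>\<^bsub>A\<^esub> a) = c \<odot>\<^bsub>A\<^esub> u a"
  using assms by (auto simp: alg_autos_def ring_hom_def Pi_iff)

lemma alg_autosI:
  assumes "u \<in> Bij (carrier A)" "u \<one>\<^bsub>A\<^esub> = \<one>\<^bsub>A\<^esub>"
    and "\<And>a b. \<lbrakk>a \<in> carrier A; b \<in> carrier A\<rbrakk> \<Longrightarrow> u (a \<otimes>\<^bsub>A\<^esub> b) = u a \<otimes>\<^bsub>A\<^esub> u b"
    and "\<And>a b. \<lbrakk>a \<in> carrier A; b \<in> carrier A\<rbrakk> \<Longrightarrow> u (a \<oplus>\<^bsub>A\<^esub> b) = u a \<oplus>\<^bsub>A\<^esub> u b"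
    and "\<And>c a. \<lbrakk>c \<in> carrier K; a \<in> carrier A\<rbrakk> \<Longrightarrow> u (c \<odot>\<^bsub>A\<^esub> a) = c \<odot>\<^bsub>A\<^esub> u a"
  shows "u \<in> alg_autos K A"
  using assms Bij_imp_funcset[OF assms(1)] by (auto simp: alg_autos_def ring_hom_def)

lemma inv_into_alg_aut:
  assumes u: "u \<in> alg_autos K A"
  shows "restrict (inv_into (carrier A) u) (carrier A) \<in> alg_autos K A"
proof -
  note U = alg_autosD[OF u]
  let ?w = "inv_into (carrier A) u"
  have inj: "inj_on u (carrier A)" and img: "u ` carrier A = carrier A"
    using U(1) by (auto simp: Bij_def bij_betw_def)
  have w: "?w a \<in> carrier A" "u (?w a) = a" if "a \<in> carrier A" for a
    using that img by (auto intro: inv_into_into f_inv_into_f)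
  \<comment> \<open>Each law for the inverse reduces to the same law for \<open>u\<close>, since
    naming a preimage of \<open>a\<close> determines \<open>?w a\<close>.\<close>
  have eq: "?w a = b" if "b \<in> carrier A" "u b = a" for a b
    using that inj by (auto intro: inv_into_f_eq)
  show ?thesis
    by (rule alg_autosI[OF restrict_inv_into_Bij[OF U(1)]])
      (use U w in \<open>auto intro!: eq simp: add_closed scale_closed\<close>)
qed

lemma subgroup_alg_autos: "subgroup (alg_autos K A) (BijGroup (carrier A))"
proof (rule subgroup.intro)
  show "alg_autos K A \<subseteq> carrier (BijGroup (carrier A))"
    by (auto simp: alg_autos_def BijGroup_def)
next
  fix u v assume "u \<in> alg_autos K A" "v \<in> alg_autos K A"
  note U = alg_autosD[OF this(1)] and V = alg_autosD[OF this(2)]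
  show "u \<otimes>\<^bsub>BijGroup (carrier A)\<^esub> v \<in> alg_autos K A"
    by (rule alg_autosI)
      (use U V in \<open>auto simp: BijGroup_def compose_Bij compose_eq add_closed scale_closed\<close>)
next
  show "\<one>\<^bsub>BijGroup (carrier A)\<^esub> \<in> alg_autos K A"
    by (rule alg_autosI) (auto simp: BijGroup_def id_Bij add_closed scale_closed)
next
  fix u assume "u \<in> alg_autos K A"
  then show "inv\<^bsub>BijGroup (carrier A)\<^esub> u \<in> alg_autos K A"
    using inv_into_alg_aut by (simp add: inv_BijGroup alg_aut_Bij)
qed

lemma group_Alg_Aut: "group (Alg_Aut K A)"
  unfolding Alg_Aut_def by (rule subgroup.subgroup_is_group[OF subgroup_alg_autos group_BijGroup])

lemma carrier_Alg_Aut: "carrier (Alg_Aut K A) = alg_autos K A"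
  by (simp add: Alg_Aut_def)

lemma one_Alg_Aut: "\<one>\<^bsub>Alg_Aut K A\<^esub> = (\<lambda>a \<in> carrier A. a)"
  by (simp add: Alg_Aut_def BijGroup_def)

lemma mult_Alg_Aut:
  "\<lbrakk>u \<in> alg_autos K A; v \<in> alg_autos K A\<rbrakk> \<Longrightarrow> u \<otimes>\<^bsub>Alg_Aut K A\<^esub> v = compose (carrier A) u v"
  by (simp add: Alg_Aut_def BijGroup_def alg_aut_Bij)

lemma inv_Alg_Aut_closed: "u \<in> alg_autos K A \<Longrightarrow> inv\<^bsub>Alg_Aut K A\<^esub> u \<in> alg_autos K A"
  using group.inv_closed[OF group_Alg_Aut] by (simp add: carrier_Alg_Aut)

lemma inv_Alg_Aut_apply:
  assumes "u \<in> alg_autos K A" "a \<in> carrier A"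
  shows "(inv\<^bsub>Alg_Aut K A\<^esub> u) (u a) = a" "u ((inv\<^bsub>Alg_Aut K A\<^esub> u) a) = a"
proof -
  interpret Aut: group "Alg_Aut K A" by (rule group_Alg_Aut)
  have "compose (carrier A) (inv\<^bsub>Alg_Aut K A\<^esub> u) u = (\<lambda>a \<in> carrier A. a)"
    "compose (carrier A) u (inv\<^bsub>Alg_Aut K A\<^esub> u) = (\<lambda>a \<in> carrier A. a)"
    using Aut.l_inv[of u] Aut.r_inv[of u] assms
    by (simp_all add: carrier_Alg_Aut mult_Alg_Aut inv_Alg_Aut_closed one_Alg_Aut)
  then show "(inv\<^bsub>Alg_Aut K A\<^esub> u) (u a) = a" "u ((inv\<^bsub>Alg_Aut K A\<^esub> u) a) = a"
    using assms(2) by (auto simp: compose_def fun_eq_iff split: if_splits)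
qed

section \<open>The Nakayama Jacobian: existence, composition law, cocycle\<close>

text \<open>Putting \<open>a = 1\<close> into the defining identity shows that
  \<open>form j b\<close> equals \<open>form (u 1) (u b)\<close>, and nondegeneracy does the rest.
  All later Jacobians are evaluated through this rule rather than through the
  \<open>THE\<close>.\<close>

lemma nakayama_jac_unique:
  assumes "j \<in> carrier A"
    and "\<And>a b. \<lbrakk>a \<in> carrier A; b \<in> carrier A\<rbrakk> \<Longrightarrow> form (u a) (u b) = form (j \<otimes>\<^bsub>A\<^esub> a) b"
  shows "nakayama_jac A form u = j"
  unfolding nakayama_jac_def
proof (rule the_equality)
  fix j' assume j': "j' \<in> carrier A \<and>
    (\<forall>a \<in> carrier A. \<forall>b \<in> carrier A. form (u a) (u b) = form (j' \<otimes>\<^bsub>A\<^esub> a) b)"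
  show "j' = j"
  proof (rule form_nondegenerate)
    fix b assume "b \<in> carrier A"
    then show "form j' b = form j b"
      using j' assms(2)[of "\<one>\<^bsub>A\<^esub>" b] assms(1) one_closed by force
  qed (use j' assms in auto)
qed (use assms in auto)

text \<open>Representability supplies \<open>j\<close> for the functional sending \<open>a\<close>
  to \<open>form 1 (u a)\<close>. As \<open>u\<close> is multiplicative and the form associative,
  both sides of the two-variable identity depend only on the product of \<open>a\<close> and
  \<open>b\<close>, so the one-variable identity suffices.\<close>

lemma nakayama_jac:
  assumes u: "u \<in> alg_autos K A"
  shows nakayama_jac_closed: "nakayama_jac A form u \<in> carrier A"
    and nakayama_jac_form: "\<And>a b. \<lbrakk>a \<in> carrier A; b \<in> carrier A\<rbrakk> \<Longrightarrow>
      form (u a) (u b) = form (nakayama_jac A form u \<otimes>\<^bsub>A\<^esub> a) b"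
proof -
  note U = alg_autosD[OF u]
  have "\<exists>j \<in> carrier A. \<forall>a \<in> carrier A. form \<one>\<^bsub>A\<^esub> (u a) = form j a"
    by (rule form_represents) (use U in \<open>auto simp: form_closed form_add form_smult\<close>)
  then obtain j where j: "j \<in> carrier A" "\<And>a. a \<in> carrier A \<Longrightarrow> form \<one>\<^bsub>A\<^esub> (u a) = form j a"
    by blast
  have form: "form (u a) (u b) = form (j \<otimes>\<^bsub>A\<^esub> a) b" if "a \<in> carrier A" "b \<in> carrier A" for a b
  proof -
    have "form (u a) (u b) = form (\<one>\<^bsub>A\<^esub> \<otimes>\<^bsub>A\<^esub> u a) (u b)" using that U by simp
    also have "\<dots> = form \<one>\<^bsub>A\<^esub> (u (a \<otimes>\<^bsub>A\<^esub> b))"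
      using that U by (subst form_assoc) auto
    also have "\<dots> = form (j \<otimes>\<^bsub>A\<^esub> a) b"
      using that j by (simp add: form_assoc)
    finally show ?thesis .
  qed
  have "nakayama_jac A form u = j"
    using j(1) form by (rule nakayama_jac_unique)
  then show "nakayama_jac A form u \<in> carrier A"
    "\<And>a b. \<lbrakk>a \<in> carrier A; b \<in> carrier A\<rbrakk> \<Longrightarrow>
      form (u a) (u b) = form (nakayama_jac A form u \<otimes>\<^bsub>A\<^esub> a) b"
    using j form by auto
qed

lemma nakayama_jac_one: "nakayama_jac A form (\<lambda>a \<in> carrier A. a) = \<one>\<^bsub>A\<^esub>"
  by (rule nakayama_jac_unique) auto

text \<open>Apply the defining identity of \<open>u\<close>, then that of \<open>v\<close>. In
  between, the Jacobian of \<open>u\<close> has to be written as a value of \<open>v\<close>, which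
  is where the inverse of \<open>v\<close> enters.\<close>

lemma nakayama_jac_compose:
  assumes u: "u \<in> alg_autos K A" and v: "v \<in> alg_autos K A"
  shows "nakayama_jac A form (compose (carrier A) u v) =
    nakayama_jac A form v \<otimes>\<^bsub>A\<^esub> (inv\<^bsub>Alg_Aut K A\<^esub> v) (nakayama_jac A form u)"
proof (rule nakayama_jac_unique)
  let ?j = "nakayama_jac A form u" and ?w = "inv\<^bsub>Alg_Aut K A\<^esub> v"
  note V = alg_autosD[OF v]
  have j: "?j \<in> carrier A" "?w ?j \<in> carrier A"
    using nakayama_jac_closed[OF u] alg_aut_closed[OF inv_Alg_Aut_closed[OF v]] by auto
  then show "nakayama_jac A form v \<otimes>\<^bsub>A\<^esub> ?w ?j \<in> carrier A"
    using nakayama_jac_closed[OF v] by simp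
  fix a b assume ab: "a \<in> carrier A" "b \<in> carrier A"
  then have "form (compose (carrier A) u v a) (compose (carrier A) u v b) = form (?j \<otimes>\<^bsub>A\<^esub> v a) (v b)"
    using V by (simp add: compose_eq nakayama_jac_form[OF u])
  also have "\<dots> = form (v (?w ?j \<otimes>\<^bsub>A\<^esub> a)) (v b)"
    using ab j V by (simp add: inv_Alg_Aut_apply[OF v])
  also have "\<dots> = form (nakayama_jac A form v \<otimes>\<^bsub>A\<^esub> ?w ?j \<otimes>\<^bsub>A\<^esub> a) b"
    using ab j nakayama_jac_closed[OF v] by (simp add: nakayama_jac_form[OF v] m_assoc)
  finally show "form (compose (carrier A) u v a) (compose (carrier A) u v b) =
    form (nakayama_jac A form v \<otimes>\<^bsub>A\<^esub> ?w ?j \<otimes>\<^bsub>A\<^esub> a) b" .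
qed

text \<open>This is the composition law for \<open>u\<close> and its inverse, whose composite is the
  identity with Jacobian 1.\<close>

lemma nakayama_jac_inv:
  assumes u: "u \<in> alg_autos K A"
  shows "nakayama_jac A form (inv\<^bsub>Alg_Aut K A\<^esub> u) \<otimes>\<^bsub>A\<^esub> u (nakayama_jac A form u) = \<one>\<^bsub>A\<^esub>"
proof -
  interpret Aut: group "Alg_Aut K A" by (rule group_Alg_Aut)
  have uG: "u \<in> carrier (Alg_Aut K A)"
    using u by (simp add: carrier_Alg_Aut)
  have "compose (carrier A) u (inv\<^bsub>Alg_Aut K A\<^esub> u) = (\<lambda>a \<in> carrier A. a)"
    using Aut.r_inv[OF uG] mult_Alg_Aut[OF u inv_Alg_Aut_closed[OF u]] by (simp add: one_Alg_Aut)
  then show ?thesis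
    using nakayama_jac_compose[OF u inv_Alg_Aut_closed[OF u]] nakayama_jac_one Aut.inv_inv[OF uG]
    by simp
qed

text \<open>Two uses of \<open>nakayama_jac_inv\<close> give the two sides. For the inverse
  \<open>w\<close> of \<open>u\<close> it makes \<open>w (jac w)\<close> a right inverse of
  \<open>jac u\<close>; for \<open>u\<close> itself, after applying \<open>w\<close>, it makes the
  same element a left inverse.\<close>

lemma nakayama_jac_unit:
  assumes u: "u \<in> alg_autos K A"
  shows "nakayama_jac A form u \<in> Units A"
proof -
  interpret Aut: group "Alg_Aut K A" by (rule group_Alg_Aut)
  let ?w = "inv\<^bsub>Alg_Aut K A\<^esub> u" and ?j = "nakayama_jac A form"
  have w: "?w \<in> alg_autos K A" and [simp]: "inv\<^bsub>Alg_Aut K A\<^esub> ?w = u"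
    using u inv_Alg_Aut_closed Aut.inv_inv[of u] by (auto simp: carrier_Alg_Aut)
  note W = alg_autosD[OF w]
  have j: "?j u \<in> carrier A" "?j ?w \<in> carrier A" "?w (?j ?w) \<in> carrier A" "u (?j u) \<in> carrier A"
    using nakayama_jac_closed alg_aut_closed u w by auto
  have right: "?j u \<otimes>\<^bsub>A\<^esub> ?w (?j ?w) = \<one>\<^bsub>A\<^esub>"
    using nakayama_jac_inv[OF w] by simp
  have "?w (?j ?w \<otimes>\<^bsub>A\<^esub> u (?j u)) = ?w (?j ?w) \<otimes>\<^bsub>A\<^esub> ?j u"
    using j W(4) by (simp add: inv_Alg_Aut_apply[OF u])
  then have "?w (?j ?w) \<otimes>\<^bsub>A\<^esub> ?j u = \<one>\<^bsub>A\<^esub>"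
    using W(2) by (simp add: nakayama_jac_inv[OF u])
  then show ?thesis
    using right j unfolding Units_def by blast
qed

text \<open>Inversion reverses products, so the composition law at the inverses of \<open>v\<close>
  and \<open>u\<close> has the factor of \<open>u\<close> first and the other factor twisted by
  \<open>u\<close>, as the cocycle law demands. This is why the Jacobian is taken at the
  inverse.\<close>

lemma nakayama_jac_cocycle:
  "(\<lambda>u \<in> carrier (Alg_Aut K A). nakayama_jac A form (inv\<^bsub>Alg_Aut K A\<^esub> u))
    \<in> cocycles (Alg_Aut K A) (units_of A) (eval_units A)"
proof -
  interpret Aut: group "Alg_Aut K A" by (rule group_Alg_Aut)
  have "nakayama_jac A form (inv\<^bsub>Alg_Aut K A\<^esub> (u \<otimes>\<^bsub>Alg_Aut K A\<^esub> v)) =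
      nakayama_jac A form (inv\<^bsub>Alg_Aut K A\<^esub> u) \<otimes>\<^bsub>A\<^esub> u (nakayama_jac A form (inv\<^bsub>Alg_Aut K A\<^esub> v))"
    if "u \<in> alg_autos K A" "v \<in> alg_autos K A" for u v
    using that Aut.inv_mult_group[of u v] Aut.inv_inv[of u]
      nakayama_jac_compose[of "inv\<^bsub>Alg_Aut K A\<^esub> v" "inv\<^bsub>Alg_Aut K A\<^esub> u"]
    by (simp add: carrier_Alg_Aut mult_Alg_Aut inv_Alg_Aut_closed)
  then show ?thesis
    using Aut.m_closed
    by (auto simp: cocycles_def carrier_Alg_Aut units_of_carrier units_of_mult eval_units_def
        nakayama_jac_unit inv_Alg_Aut_closed)
qed

lemma alg_aut_one_eval_units:
  "u \<in> alg_autos K A \<Longrightarrow> eval_units A u \<one>\<^bsub>units_of A\<^esub> = \<one>\<^bsub>units_of A\<^esub>"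
  by (simp add: eval_units_def units_of_one alg_aut_one)

end

section \<open>The trivial extension\<close>

context assoc_algebra
begin

section \<open>The trivial extension and its Frobenius form\<close>

lemma dual_bimod_closed:
  assumes "x \<in> carrier B" "y \<in> carrier B" "l \<in> dual_space K B"
  shows "dual_bimod B x l y \<in> dual_space K B"
  by (rule dual_spaceI)
    (use assms in \<open>auto simp: dual_bimod_def dual_space_closed dual_space_add dual_space_smult
      B.l_distr B.r_distr smult_mult_left smult_mult_right\<close>)

lemma dual_bimod_apply:
  assumes "x \<in> carrier B" "b \<in> carrier B"
  shows "dual_bimod B x l \<one>\<^bsub>B\<^esub> b = l (b \<otimes>\<^bsub>B\<^esub> x)" "dual_bimod B \<one>\<^bsub>B\<^esub> l x b = l (x \<otimes>\<^bsub>B\<^esub> b)"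
  using assms by (simp_all add: dual_bimod_def)

lemma trivext_simps:
  "carrier (trivial_extension K B) = carrier B \<times> dual_space K B"
  "(x, x') \<otimes>\<^bsub>trivial_extension K B\<^esub> (y, y') =
    (x \<otimes>\<^bsub>B\<^esub> y, dual_add K B (dual_bimod B x y' \<one>\<^bsub>B\<^esub>) (dual_bimod B \<one>\<^bsub>B\<^esub> x' y))"
  "\<one>\<^bsub>trivial_extension K B\<^esub> = (\<one>\<^bsub>B\<^esub>, dual_zero K B)"
  "(x, x') \<oplus>\<^bsub>trivial_extension K B\<^esub> (y, y') = (x \<oplus>\<^bsub>B\<^esub> y, dual_add K B x' y')"
  "c \<odot>\<^bsub>trivial_extension K B\<^esub> (x, x') = (c \<odot>\<^bsub>B\<^esub> x, dual_smult K B c x')"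
  by (simp_all add: trivial_extension_def)

lemmas dual_closed = dual_zero_closed dual_add_closed dual_smult_closed dual_bimod_closed
lemmas dual_apply = dual_zero_apply dual_add_apply dual_smult_apply dual_bimod_apply
  dual_space_closed dual_space_add dual_space_smult dual_space_zero

text \<open>Forms are compared at each vector of \<open>B\<close>. Both bracketings of three pairs
  have as second component the sum of the three terms in which exactly one factor is a form.\<close>

lemma monoid_trivext: "monoid (trivial_extension K B)"
proof (rule monoidI)
  fix a b c
  assume "a \<in> carrier (trivial_extension K B)" "b \<in> carrier (trivial_extension K B)"
    "c \<in> carrier (trivial_extension K B)"
  then show "a \<otimes>\<^bsub>trivial_extension K B\<^esub> b \<otimes>\<^bsub>trivial_extension K B\<^esub> c =
      a \<otimes>\<^bsub>trivial_extension K B\<^esub> (b \<otimes>\<^bsub>trivial_extension K B\<^esub> c)"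
    by (auto simp: trivext_simps B.m_assoc dual_closed dual_apply R.a_assoc intro!: dual_space_ext)
qed (auto simp: trivext_simps dual_closed dual_apply intro!: dual_space_ext)

text \<open>Finite dimension enters twice: separation of points gives nondegeneracy, reflexivity
  gives representability. Test pairs \<open>(b, 0)\<close> isolate the form component and pairs
  \<open>(0, l)\<close> the vector component.\<close>

lemma frobenius_form_trivext:
  assumes fin_dim
  shows "frobenius_form K (trivial_extension K B) (trivext_form K)"
proof -
  interpret A: monoid "trivial_extension K B" by (rule monoid_trivext)
  show ?thesis
  proof
    fix a a'
    assume a: "a \<in> carrier (trivial_extension K B)" and a': "a' \<in> carrier (trivial_extension K B)"
      and eq: "\<And>b. b \<in> carrier (trivial_extension K B) \<Longrightarrow> trivext_form K a b = trivext_form K a' b"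
    obtain x x' y y' where xy: "a = (x, x')" "a' = (y, y')" by force
    have "x' = y'"
    proof (rule dual_space_ext)
      fix b assume "b \<in> carrier B"
      then show "x' b = y' b"
        using eq[of "(b, dual_zero K B)"] a a'
        by (simp add: xy trivext_form_def trivext_simps dual_closed dual_apply)
    qed (use a a' xy in \<open>auto simp: trivext_simps\<close>)
    moreover have "x = y"
    proof (rule dual_separates_points[OF \<open>fin_dim\<close>])
      fix l assume "l \<in> dual_space K B"
      then show "l x = l y"
        using eq[of "(\<zero>\<^bsub>B\<^esub>, l)"] a a'
        by (simp add: xy trivext_form_def trivext_simps dual_closed dual_apply)
    qed (use a a' xy in \<open>auto simp: trivext_simps\<close>)
    ultimately show "a = a'" by (simp add: xy)
  next
    fix F :: "'b \<times> ('b \<Rightarrow> 'k) \<Rightarrow> 'k"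
    assume closed: "\<And>a. a \<in> carrier (trivial_extension K B) \<Longrightarrow> F a \<in> carrier K"
      and add: "\<And>a b. \<lbrakk>a \<in> carrier (trivial_extension K B); b \<in> carrier (trivial_extension K B)\<rbrakk> \<Longrightarrow>
        F (a \<oplus>\<^bsub>trivial_extension K B\<^esub> b) = F a \<oplus>\<^bsub>K\<^esub> F b"
      and smult: "\<And>c a. \<lbrakk>c \<in> carrier K; a \<in> carrier (trivial_extension K B)\<rbrakk> \<Longrightarrow>
        F (c \<odot>\<^bsub>trivial_extension K B\<^esub> a) = c \<otimes>\<^bsub>K\<^esub> F a"
    \<comment> \<open>These keep the pairs \<open>(b, 0)\<close> closed under sums and multiples, so
      that \<open>F\<close> restricts to a linear form on \<open>B\<close>.\<close>
    have zz: "dual_add K B (dual_zero K B) (dual_zero K B) = dual_zero K B"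
      "\<And>c. c \<in> carrier K \<Longrightarrow> dual_smult K B c (dual_zero K B) = dual_zero K B"
      by (auto simp: dual_closed dual_apply intro!: dual_space_ext)
    \<comment> \<open>The pairing is crosswise: the form component \<open>j'\<close> is
      \<open>F\<close> on \<open>B\<close>, while the vector component \<open>j\<close> comes by
      reflexivity from \<open>F\<close> on the dual.\<close>
    define j' where "j' = (\<lambda>b \<in> carrier B. F (b, dual_zero K B))"
    have j': "j' \<in> dual_space K B"
    proof (rule dual_spaceI)
      fix x y assume "x \<in> carrier B" "y \<in> carrier B"
      then show "j' (x \<oplus>\<^bsub>B\<^esub> y) = j' x \<oplus>\<^bsub>K\<^esub> j' y"
        using add[of "(x, dual_zero K B)" "(y, dual_zero K B)"]
        by (simp add: j'_def trivext_simps zz dual_closed)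
    next
      fix c x assume "c \<in> carrier K" "x \<in> carrier B"
      then show "j' (c \<odot>\<^bsub>B\<^esub> x) = c \<otimes>\<^bsub>K\<^esub> j' x"
        using smult[of c "(x, dual_zero K B)"] by (simp add: j'_def trivext_simps zz dual_closed)
    qed (auto simp: j'_def trivext_simps dual_closed intro!: closed)
    obtain j where j: "j \<in> carrier B" "\<And>l. l \<in> dual_space K B \<Longrightarrow> F (\<zero>\<^bsub>B\<^esub>, l) = l j"
    proof (rule dual_reflexive[OF \<open>fin_dim\<close>, of "\<lambda>l. F (\<zero>\<^bsub>B\<^esub>, l)"])
      fix l m assume "l \<in> dual_space K B" "m \<in> dual_space K B"
      then show "F (\<zero>\<^bsub>B\<^esub>, dual_add K B l m) = F (\<zero>\<^bsub>B\<^esub>, l) \<oplus>\<^bsub>K\<^esub> F (\<zero>\<^bsub>B\<^esub>, m)"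
        using add[of "(\<zero>\<^bsub>B\<^esub>, l)" "(\<zero>\<^bsub>B\<^esub>, m)"] by (simp add: trivext_simps)
    next
      fix c l assume "c \<in> carrier K" "l \<in> dual_space K B"
      then show "F (\<zero>\<^bsub>B\<^esub>, dual_smult K B c l) = c \<otimes>\<^bsub>K\<^esub> F (\<zero>\<^bsub>B\<^esub>, l)"
        using smult[of c "(\<zero>\<^bsub>B\<^esub>, l)"] by (simp add: trivext_simps)
    qed (auto simp: trivext_simps intro!: closed)
    have "F (y, y') = trivext_form K (j, j') (y, y')" if "y \<in> carrier B" "y' \<in> dual_space K B" for y y'
    proof -
      have "dual_add K B (dual_zero K B) y' = y'"
        using that by (auto simp: dual_closed dual_apply intro!: dual_space_ext)
      then show ?thesis
        using that add[of "(y, dual_zero K B)" "(\<zero>\<^bsub>B\<^esub>, y')"] j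
        by (simp add: trivext_simps dual_closed trivext_form_def j'_def)
    qed
    then show "\<exists>j \<in> carrier (trivial_extension K B). \<forall>a \<in> carrier (trivial_extension K B).
        F a = trivext_form K j a"
      using j j' by (intro bexI[of _ "(j, j')"]) (auto simp: trivext_simps)
  qed (auto simp: trivext_simps trivext_form_def dual_closed dual_apply R.r_distr R.a_ac)
qed

section \<open>Central units, the automorphisms \<open>u_z\<close> and their Jacobians\<close>

lemma group_central_units: "group (central_units B)"
proof -
  interpret U: group "units_of B" by (rule B.units_group)
  have "subgroup (Units B \<inter> ring_center B) (units_of B)"
  proof (rule U.subgroupI)
    show "Units B \<inter> ring_center B \<noteq> {}"
      by (auto simp: ring_center_def intro: exI[of _ "\<one>\<^bsub>B\<^esub>"])
  next
    fix z assume "z \<in> Units B \<inter> ring_center B"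
    then have z: "z \<in> Units B" and comm: "\<And>x. x \<in> carrier B \<Longrightarrow> z \<otimes>\<^bsub>B\<^esub> x = x \<otimes>\<^bsub>B\<^esub> z"
      by (auto simp: ring_center_def)
    have zc: "z \<in> carrier B" "inv\<^bsub>B\<^esub> z \<in> carrier B"
      using z by (auto simp: B.Units_closed)
    have "inv\<^bsub>B\<^esub> z \<otimes>\<^bsub>B\<^esub> x = x \<otimes>\<^bsub>B\<^esub> inv\<^bsub>B\<^esub> z" if x: "x \<in> carrier B" for x
    proof -
      \<comment> \<open>Inserting \<open>z\<close> and its inverse after \<open>x\<close> lets
        centrality move \<open>z\<close> to the left of \<open>x\<close>, where it cancels.\<close>
      have "inv\<^bsub>B\<^esub> z \<otimes>\<^bsub>B\<^esub> x = inv\<^bsub>B\<^esub> z \<otimes>\<^bsub>B\<^esub> (x \<otimes>\<^bsub>B\<^esub> z) \<otimes>\<^bsub>B\<^esub> inv\<^bsub>B\<^esub> z"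
        using z zc x by (simp add: B.m_assoc)
      also have "x \<otimes>\<^bsub>B\<^esub> z = z \<otimes>\<^bsub>B\<^esub> x"
        using comm[OF x] ..
      also have "inv\<^bsub>B\<^esub> z \<otimes>\<^bsub>B\<^esub> (z \<otimes>\<^bsub>B\<^esub> x) = x"
        using z zc x by (simp add: B.m_assoc[symmetric])
      finally show ?thesis .
    qed
    then show "inv\<^bsub>units_of B\<^esub> z \<in> Units B \<inter> ring_center B"
      using z by (simp add: B.units_of_inv ring_center_def)
  next
    fix z w assume zw: "z \<in> Units B \<inter> ring_center B" "w \<in> Units B \<inter> ring_center B"
    have "z \<otimes>\<^bsub>B\<^esub> w \<otimes>\<^bsub>B\<^esub> x = x \<otimes>\<^bsub>B\<^esub> (z \<otimes>\<^bsub>B\<^esub> w)" if x: "x \<in> carrier B" for x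
    proof -
      have c: "z \<in> carrier B" "w \<in> carrier B" "z \<otimes>\<^bsub>B\<^esub> x = x \<otimes>\<^bsub>B\<^esub> z" "w \<otimes>\<^bsub>B\<^esub> x = x \<otimes>\<^bsub>B\<^esub> w"
        using zw x by (auto simp: ring_center_def)
      then have "z \<otimes>\<^bsub>B\<^esub> w \<otimes>\<^bsub>B\<^esub> x = z \<otimes>\<^bsub>B\<^esub> x \<otimes>\<^bsub>B\<^esub> w"
        using x by (metis B.m_assoc)
      then show ?thesis
        using c x by (simp add: B.m_assoc)
    qed
    moreover have "z \<otimes>\<^bsub>B\<^esub> w \<in> Units B"
      using zw by simp
    ultimately show "z \<otimes>\<^bsub>units_of B\<^esub> w \<in> Units B \<inter> ring_center B"
      by (simp add: units_of_mult ring_center_def B.Units_closed)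
  qed (auto simp: units_of_carrier)
  then show ?thesis
    unfolding central_units_def by (rule subgroup.subgroup_is_group[OF _ B.units_group])
qed

lemma central_units_simps:
  "carrier (central_units B) = Units B \<inter> ring_center B"
  "z \<otimes>\<^bsub>central_units B\<^esub> w = z \<otimes>\<^bsub>B\<^esub> w" "\<one>\<^bsub>central_units B\<^esub> = \<one>\<^bsub>B\<^esub>"
  by (simp_all add: central_units_def units_of_def)

lemma central_unitsD:
  assumes "z \<in> carrier (central_units B)"
  shows "z \<in> carrier B" "\<And>x. x \<in> carrier B \<Longrightarrow> x \<otimes>\<^bsub>B\<^esub> z = z \<otimes>\<^bsub>B\<^esub> x"
  using assms by (auto simp: central_units_simps ring_center_def)

lemma transpose_map_apply:
  "b \<in> carrier B \<Longrightarrow> transpose_map B (mult_map B z) l b = l (z \<otimes>\<^bsub>B\<^esub> b)"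
  by (simp add: transpose_map_def mult_map_def compose_eq)

lemma transpose_map_closed:
  assumes "z \<in> carrier B" "l \<in> dual_space K B"
  shows "transpose_map B (mult_map B z) l \<in> dual_space K B"
proof (rule dual_spaceI)
  show "transpose_map B (mult_map B z) l \<in> extensional (carrier B)"
    by (simp add: transpose_map_def)
qed (use assms in \<open>auto simp: transpose_map_apply dual_apply B.r_distr smult_mult_right\<close>)

lemma central_unit_aut_apply:
  "\<lbrakk>x \<in> carrier B; x' \<in> dual_space K B\<rbrakk> \<Longrightarrow>
    central_unit_aut K B z (x, x') = (x, transpose_map B (mult_map B z) x')"
  by (simp add: central_unit_aut_def trivext_simps)

text \<open>Transposition reverses the order of the two multiplications; since central units
  commute, the order is restored.\<close>

lemma central_unit_aut_mult:
  assumes "z \<in> carrier (central_units B)" "w \<in> carrier (central_units B)"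
  shows "compose (carrier (trivial_extension K B)) (central_unit_aut K B z) (central_unit_aut K B w) =
    central_unit_aut K B (z \<otimes>\<^bsub>B\<^esub> w)"
proof (rule extensionalityI)
  note Z = central_unitsD[OF assms(1)] and W = central_unitsD[OF assms(2)]
  fix a assume "a \<in> carrier (trivial_extension K B)"
  then obtain x x' where a: "a = (x, x')" "x \<in> carrier B" "x' \<in> dual_space K B"
    by (auto simp: trivext_simps)
  have "transpose_map B (mult_map B z) (transpose_map B (mult_map B w) x') =
      transpose_map B (mult_map B (z \<otimes>\<^bsub>B\<^esub> w)) x'"
    by (rule dual_space_ext) (use Z(1) W(1) W(2)[OF Z(1)] a in
      \<open>auto simp: transpose_map_closed transpose_map_apply B.m_assoc[symmetric]\<close>)
  then show "compose (carrier (trivial_extension K B)) (central_unit_aut K B z)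
      (central_unit_aut K B w) a = central_unit_aut K B (z \<otimes>\<^bsub>B\<^esub> w) a"
    using Z(1) W(1) a by (simp add: compose_eq trivext_simps central_unit_aut_apply transpose_map_closed)
qed (auto simp: central_unit_aut_def)

lemma central_unit_aut_one:
  "central_unit_aut K B \<one>\<^bsub>B\<^esub> = (\<lambda>a \<in> carrier (trivial_extension K B). a)"
proof (rule extensionalityI)
  fix a assume "a \<in> carrier (trivial_extension K B)"
  then obtain x x' where a: "a = (x, x')" "x \<in> carrier B" "x' \<in> dual_space K B"
    by (auto simp: trivext_simps)
  have "transpose_map B (mult_map B \<one>\<^bsub>B\<^esub>) x' = x'"
    by (rule dual_space_ext) (use a in \<open>auto simp: transpose_map_closed transpose_map_apply\<close>)
  then show "central_unit_aut K B \<one>\<^bsub>B\<^esub> a = (\<lambda>a \<in> carrier (trivial_extension K B). a) a"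
    using a by (simp add: trivext_simps central_unit_aut_apply)
qed (auto simp: central_unit_aut_def)

lemma central_unit_aut_closed:
  assumes "z \<in> carrier (central_units B)" "a \<in> carrier (trivial_extension K B)"
  shows "central_unit_aut K B z a \<in> carrier (trivial_extension K B)"
  using assms central_unitsD[OF assms(1)]
  by (auto simp: trivext_simps central_unit_aut_apply transpose_map_closed)

lemma central_unit_aut_inverse:
  assumes z: "z \<in> carrier (central_units B)"
  shows "compose (carrier (trivial_extension K B)) (central_unit_aut K B (inv\<^bsub>central_units B\<^esub> z))
      (central_unit_aut K B z) = (\<lambda>a \<in> carrier (trivial_extension K B). a)"
    and "compose (carrier (trivial_extension K B)) (central_unit_aut K B z)
      (central_unit_aut K B (inv\<^bsub>central_units B\<^esub> z)) = (\<lambda>a \<in> carrier (trivial_extension K B). a)"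
proof -
  interpret Z: group "central_units B" by (rule group_central_units)
  show "compose (carrier (trivial_extension K B)) (central_unit_aut K B (inv\<^bsub>central_units B\<^esub> z))
      (central_unit_aut K B z) = (\<lambda>a \<in> carrier (trivial_extension K B). a)"
    and "compose (carrier (trivial_extension K B)) (central_unit_aut K B z)
      (central_unit_aut K B (inv\<^bsub>central_units B\<^esub> z)) = (\<lambda>a \<in> carrier (trivial_extension K B). a)"
    using z Z.inv_closed[OF z] Z.l_inv[OF z] Z.r_inv[OF z]
    by (simp_all add: central_unit_aut_mult central_unit_aut_one central_units_simps(2,3))
qed

lemma central_unit_aut_alg_aut:
  assumes fin_dim and z: "z \<in> carrier (central_units B)"
  shows "central_unit_aut K B z \<in> alg_autos K (trivial_extension K B)"
proof -
  interpret A: frobenius_form K "trivial_extension K B" "trivext_form K"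
    by (rule frobenius_form_trivext[OF \<open>fin_dim\<close>])
  interpret Z: group "central_units B" by (rule group_central_units)
  note Zc = central_unitsD[OF z]
  show ?thesis
  proof (rule A.alg_autosI)
    \<comment> \<open>The two-sided inverse is the map belonging to the inverse unit.\<close>
    have "bij_betw (central_unit_aut K B z) (carrier (trivial_extension K B))
        (carrier (trivial_extension K B))"
      using central_unit_aut_inverse[OF z] central_unit_aut_closed[OF z]
        central_unit_aut_closed[OF Z.inv_closed[OF z]]
      by (intro bij_betw_byWitness[where f' = "central_unit_aut K B (inv\<^bsub>central_units B\<^esub> z)"])
        (auto simp: compose_def fun_eq_iff split: if_splits)
    then show "central_unit_aut K B z \<in> Bij (carrier (trivial_extension K B))"
      by (auto simp: Bij_def central_unit_aut_def)
  next
    fix a b assume "a \<in> carrier (trivial_extension K B)" "b \<in> carrier (trivial_extension K B)"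
    then obtain x x' y y' where a: "a = (x, x')" "x \<in> carrier B" "x' \<in> dual_space K B"
      and b: "b = (y, y')" "y \<in> carrier B" "y' \<in> dual_space K B"
      by (auto simp: trivext_simps)
    \<comment> \<open>In the second component of the product, the term with \<open>y'\<close>
      matches by associativity, but the term with \<open>x'\<close> needs \<open>z\<close> to
      commute with \<open>y\<close>.\<close>
    have "x' (y \<otimes>\<^bsub>B\<^esub> (z \<otimes>\<^bsub>B\<^esub> t)) = x' (z \<otimes>\<^bsub>B\<^esub> (y \<otimes>\<^bsub>B\<^esub> t))" if "t \<in> carrier B" for t
      using a b Zc that by (simp add: B.m_assoc[symmetric])
    then show "central_unit_aut K B z (a \<otimes>\<^bsub>trivial_extension K B\<^esub> b) =
        central_unit_aut K B z a \<otimes>\<^bsub>trivial_extension K B\<^esub> central_unit_aut K B z b"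
      using a b Zc
      by (auto simp: trivext_simps central_unit_aut_apply transpose_map_closed transpose_map_apply
          dual_closed dual_apply B.m_assoc intro!: dual_space_ext)
  qed (use Zc in \<open>auto simp: trivext_simps central_unit_aut_apply transpose_map_closed
      transpose_map_apply dual_closed dual_apply intro!: dual_space_ext\<close>)
qed

lemma inv_central_unit_aut:
  assumes fin_dim and z: "z \<in> carrier (central_units B)"
  shows "inv\<^bsub>Alg_Aut K (trivial_extension K B)\<^esub> (central_unit_aut K B z) =
    central_unit_aut K B (inv\<^bsub>central_units B\<^esub> z)"
proof -
  interpret A: frobenius_form K "trivial_extension K B" "trivext_form K"
    by (rule frobenius_form_trivext[OF \<open>fin_dim\<close>])
  interpret Aut: group "Alg_Aut K (trivial_extension K B)" by (rule A.group_Alg_Aut)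
  interpret Z: group "central_units B" by (rule group_central_units)
  show ?thesis
    using central_unit_aut_alg_aut[OF \<open>fin_dim\<close>] z Z.inv_closed[OF z] central_unit_aut_inverse[OF z]
    by (intro Aut.inv_equality) (simp_all add: A.carrier_Alg_Aut A.mult_Alg_Aut A.one_Alg_Aut)
qed

text \<open>For pairs \<open>(x, x')\<close> and \<open>(y, y')\<close> the twisted pairing is
  \<open>x' (z y) + y' (z x)\<close>. Multiplying the first pair by \<open>(z, 0)\<close> instead
  gives \<open>x' (y z) + y' (z x)\<close>, which is the same because \<open>z\<close> is
  central.\<close>

lemma nakayama_jac_central_unit_aut:
  assumes fin_dim and z: "z \<in> carrier (central_units B)"
  shows "nakayama_jac (trivial_extension K B) (trivext_form K) (central_unit_aut K B z) =
    (z, dual_zero K B)"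
proof -
  interpret A: frobenius_form K "trivial_extension K B" "trivext_form K"
    by (rule frobenius_form_trivext[OF \<open>fin_dim\<close>])
  note Zc = central_unitsD[OF z]
  show ?thesis
    by (rule A.nakayama_jac_unique)
      (use Zc in \<open>auto simp: trivext_simps trivext_form_def central_unit_aut_apply
        transpose_map_apply dual_closed dual_apply\<close>)
qed

section \<open>Projection of units and cocycle relations to \<open>B\<close>\<close>

lemma fst_mult_trivext:
  "fst (a \<otimes>\<^bsub>trivial_extension K B\<^esub> b) = fst a \<otimes>\<^bsub>B\<^esub> fst b"
  by (cases a; cases b) (simp add: trivext_simps)

lemma fst_Units_trivext:
  assumes "\<xi> \<in> Units (trivial_extension K B)"
  shows "fst \<xi> \<in> Units B" "fst (inv\<^bsub>trivial_extension K B\<^esub> \<xi>) = inv\<^bsub>B\<^esub> (fst \<xi>)"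
proof -
  interpret A: monoid "trivial_extension K B" by (rule monoid_trivext)
  let ?\<eta> = "inv\<^bsub>trivial_extension K B\<^esub> \<xi>"
  have "fst (?\<eta> \<otimes>\<^bsub>trivial_extension K B\<^esub> \<xi>) = \<one>\<^bsub>B\<^esub>" "fst (\<xi> \<otimes>\<^bsub>trivial_extension K B\<^esub> ?\<eta>) = \<one>\<^bsub>B\<^esub>"
    using assms by (simp_all add: trivext_simps)
  then have inv: "fst ?\<eta> \<otimes>\<^bsub>B\<^esub> fst \<xi> = \<one>\<^bsub>B\<^esub>" "fst \<xi> \<otimes>\<^bsub>B\<^esub> fst ?\<eta> = \<one>\<^bsub>B\<^esub>"
    by (simp_all add: fst_mult_trivext)
  have carrier: "fst ?\<eta> \<in> carrier B" "fst \<xi> \<in> carrier B"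
    using A.Units_closed[OF assms] A.Units_inv_closed[OF assms] by (auto simp: trivext_simps)
  then show "fst \<xi> \<in> Units B"
    using inv unfolding Units_def by blast
  show "fst ?\<eta> = inv\<^bsub>B\<^esub> (fst \<xi>)"
    using B.inv_char[of "fst \<xi>" "fst ?\<eta>"] inv carrier by simp
qed

lemma fst_central_unit_aut:
  "a \<in> carrier (trivial_extension K B) \<Longrightarrow> fst (central_unit_aut K B z a) = fst a"
  by (cases a) (simp add: trivext_simps central_unit_aut_apply)

text \<open>\<open>u_z\<close> fixes first components, so the twist disappears under the projection
  and a change of representative becomes a plain conjugation in \<open>B\<close>.\<close>

lemma fst_twisted_conjugate:
  assumes "\<xi> \<in> Units (trivial_extension K B)" "j \<in> Units (trivial_extension K B)"
  shows "fst (inv\<^bsub>units_of (trivial_extension K B)\<^esub> \<xi> \<otimes>\<^bsub>units_of (trivial_extension K B)\<^esub> j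
      \<otimes>\<^bsub>units_of (trivial_extension K B)\<^esub> eval_units (trivial_extension K B) (central_unit_aut K B z) \<xi>) =
    inv\<^bsub>B\<^esub> (fst \<xi>) \<otimes>\<^bsub>B\<^esub> fst j \<otimes>\<^bsub>B\<^esub> fst \<xi>"
proof -
  interpret A: monoid "trivial_extension K B" by (rule monoid_trivext)
  show ?thesis
    using assms A.Units_closed[OF assms(1)]
    by (simp add: A.units_of_inv units_of_mult fst_mult_trivext eval_units_def fst_Units_trivext
        fst_central_unit_aut)
qed

lemma conjugate_eq_one_imp_eq_one:
  assumes "g \<in> Units B" "x \<in> carrier B" "inv\<^bsub>B\<^esub> g \<otimes>\<^bsub>B\<^esub> x \<otimes>\<^bsub>B\<^esub> g = \<one>\<^bsub>B\<^esub>"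
  shows "x = \<one>\<^bsub>B\<^esub>"
proof -
  have g: "g \<in> carrier B" "inv\<^bsub>B\<^esub> g \<in> carrier B"
    using assms(1) by (auto simp: B.Units_closed)
  have "x = g \<otimes>\<^bsub>B\<^esub> inv\<^bsub>B\<^esub> g \<otimes>\<^bsub>B\<^esub> x \<otimes>\<^bsub>B\<^esub> (g \<otimes>\<^bsub>B\<^esub> inv\<^bsub>B\<^esub> g)"
    using assms(1,2) by simp
  also have "\<dots> = g \<otimes>\<^bsub>B\<^esub> (inv\<^bsub>B\<^esub> g \<otimes>\<^bsub>B\<^esub> x \<otimes>\<^bsub>B\<^esub> g) \<otimes>\<^bsub>B\<^esub> inv\<^bsub>B\<^esub> g"
    using assms(2) g by (simp only: B.m_assoc B.m_closed)
  also have "\<dots> = \<one>\<^bsub>B\<^esub>"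
    using assms(1,3) g by simp
  finally show ?thesis .
qed

end

section \<open>Restricting the Jacobian class to the central units\<close>

theorem lemma28:
  fixes K :: "('k, 'c) ring_scheme" and B :: "('k, 'b, 'd) module_scheme"
    and A :: "('k, 'b \<times> ('b \<Rightarrow> 'k)) module"
  assumes "assoc_algebra K B"
    and "vectorspace.fin_dim K B"
    and "A = trivial_extension K B"
  shows "H1_res (central_units B) (units_of A) (eval_units A) (central_unit_aut K B)
           (Jac_class K A (trivext_form K))
         = H1_trivial (central_units B) (units_of A) (eval_units A \<circ> central_unit_aut K B)
       \<longleftrightarrow> trivial_group (central_units B)"
proof -
  interpret assoc_algebra K B by fact
  interpret A: frobenius_form K A "trivext_form K"
    unfolding \<open>A = _\<close> by (rule frobenius_form_trivext[OF assms(2)])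
  interpret Z: group "central_units B" by (rule group_central_units)
  let ?Z = "central_units B" and ?u = "central_unit_aut K B" and ?G = "Alg_Aut K A"
  let ?J = "\<lambda>u \<in> carrier ?G. nakayama_jac A (trivext_form K) (inv\<^bsub>?G\<^esub> u)"
  let ?one = "\<lambda>z \<in> carrier ?Z. \<one>\<^bsub>units_of A\<^esub>"
  have u: "?u z \<in> carrier ?G" if "z \<in> carrier ?Z" for z
    using central_unit_aut_alg_aut[OF assms(2) that, folded assms(3)] by (simp add: A.carrier_Alg_Aut)
  have u1: "?u \<one>\<^bsub>?Z\<^esub> = \<one>\<^bsub>?G\<^esub>"
    using central_unit_aut_one[folded assms(3)] by (simp add: central_units_simps A.one_Alg_Aut)
  have J: "?J \<in> cocycles ?G (units_of A) (eval_units A)"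
    by (rule A.nakayama_jac_cocycle)
  show ?thesis
  proof
    assume res: "H1_res ?Z (units_of A) (eval_units A) ?u (Jac_class K A (trivext_form K)) =
      H1_trivial ?Z (units_of A) (eval_units A \<circ> ?u)"
    \<comment> \<open>The restricted class is a union of classes over all representatives. Its
      equality with the trivial class is used through one common element, the constant
      cocycle.\<close>
    have "?one \<in> cocycles ?Z (units_of A) (eval_units A \<circ> ?u)"
      using u by (intro trivial_cocycle group_central_units A.units_group)
        (simp add: A.carrier_Alg_Aut A.alg_aut_one_eval_units)
    then have "?one \<in> H1_trivial ?Z (units_of A) (eval_units A \<circ> ?u)"
      using u unfolding H1_trivial_def H1_class_def
      by (auto intro!: cohomologous_refl A.units_group
          simp: A.carrier_Alg_Aut A.alg_aut_one_eval_units)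
    then obtain f where f: "f \<in> Jac_class K A (trivext_form K)"
      and "?one \<in> H1_class ?Z (units_of A) (eval_units A \<circ> ?u) (compose (carrier ?Z) f ?u)"
      using res by (auto simp: H1_res_def)
    then obtain \<eta> where \<eta>: "\<eta> \<in> Units A" and one: "\<And>z. z \<in> carrier ?Z \<Longrightarrow>
        \<one>\<^bsub>A\<^esub> = inv\<^bsub>units_of A\<^esub> \<eta> \<otimes>\<^bsub>units_of A\<^esub> f (?u z) \<otimes>\<^bsub>units_of A\<^esub> eval_units A (?u z) \<eta>"
      by (auto simp: H1_class_def cohomologous_def units_of_carrier units_of_one compose_eq)
    \<comment> \<open>\<open>f\<close> is only some representative of the Jacobian class, linked to
      \<open>?J\<close> by \<open>\<xi>\<close>, whereas \<open>\<eta>\<close> links its restriction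
      to the constant cocycle. Two conjugations therefore have to be undone.\<close>
    from f obtain \<xi> where \<xi>: "\<xi> \<in> Units A" and fc: "f \<in> cocycles ?G (units_of A) (eval_units A)"
      and fJ: "\<And>v. v \<in> carrier ?G \<Longrightarrow>
        f v = inv\<^bsub>units_of A\<^esub> \<xi> \<otimes>\<^bsub>units_of A\<^esub> ?J v \<otimes>\<^bsub>units_of A\<^esub> eval_units A v \<xi>"
      by (auto simp: Jac_class_def H1_class_def cohomologous_def units_of_carrier)
    have "z = \<one>\<^bsub>?Z\<^esub>" if z: "z \<in> carrier ?Z" for z
    proof -
      let ?w = "inv\<^bsub>?Z\<^esub> z"
      have w: "?w \<in> carrier ?Z" "?w \<in> carrier B"
        using z central_unitsD by auto
      \<comment> \<open>The inverse of \<open>u_z\<close> belongs to the inverse unit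
        \<open>?w\<close>, so its Jacobian is read off from \<open>?w\<close>. It is a unit because
        the cocycle \<open>?J\<close> takes values in the units.\<close>
      have Ju: "?J (?u z) = (?w, dual_zero K B)" "?J (?u z) \<in> Units A"
        using u[OF z] J
        by (auto simp: inv_central_unit_aut[OF assms(2) z, folded assms(3)]
            nakayama_jac_central_unit_aut[OF assms(2) w(1), folded assms(3)]
            cocycles_def units_of_carrier PiE_def Pi_iff)
      have fu: "f (?u z) \<in> Units A"
        using fc u[OF z] by (auto simp: cocycles_def units_of_carrier)
      have "fst (f (?u z)) = inv\<^bsub>B\<^esub> (fst \<xi>) \<otimes>\<^bsub>B\<^esub> ?w \<otimes>\<^bsub>B\<^esub> fst \<xi>"
        using fst_twisted_conjugate[folded assms(3), of \<xi> "?J (?u z)" z] \<xi> Ju fJ[OF u[OF z]] by simp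
      moreover have "\<one>\<^bsub>B\<^esub> = inv\<^bsub>B\<^esub> (fst \<eta>) \<otimes>\<^bsub>B\<^esub> fst (f (?u z)) \<otimes>\<^bsub>B\<^esub> fst \<eta>"
        using arg_cong[OF one[OF z], of fst] fst_twisted_conjugate[folded assms(3), of \<eta> "f (?u z)" z] \<eta> fu
          trivext_simps(3)[folded assms(3)] by simp
      moreover have "fst \<eta> \<in> Units B" "fst \<xi> \<in> Units B" "fst (f (?u z)) \<in> carrier B"
        using fst_Units_trivext(1)[folded assms(3)] \<eta> \<xi> fu B.Units_closed by auto
      \<comment> \<open>Undoing the conjugation by \<open>fst \<eta>\<close> makes
        \<open>fst (f (?u z))\<close> equal to 1; undoing the one by \<open>fst \<xi>\<close> then
        does the same for \<open>?w\<close>.\<close>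
      ultimately have "?w = \<one>\<^bsub>B\<^esub>"
        using w conjugate_eq_one_imp_eq_one by metis
      then show ?thesis
        using z Z.inv_eq_1_iff by (simp add: central_units_simps(3))
    qed
    then show "trivial_group ?Z"
      using Z.one_closed by (auto simp: trivial_group_def group_central_units)
  next
    assume "trivial_group ?Z"
    then have Z1: "carrier ?Z = {\<one>\<^bsub>?Z\<^esub>}"
      by (simp add: trivial_group_def)
    \<comment> \<open>Every representative restricts to the constant cocycle itself, as its only
      value is the one at the identity automorphism. So all classes in the union coincide.\<close>
    have "compose (carrier ?Z) f ?u = ?one" if "f \<in> Jac_class K A (trivext_form K)" for f
    proof -
      have "f \<in> cocycles ?G (units_of A) (eval_units A)"
        using that by (auto simp: Jac_class_def H1_class_def cohomologous_def)
      then have "f \<one>\<^bsub>?G\<^esub> = \<one>\<^bsub>units_of A\<^esub>"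
        by (rule cocycle_one[OF A.group_Alg_Aut A.units_group])
          (simp add: eval_units_def units_of_carrier A.one_Alg_Aut A.Units_closed)
      then show ?thesis
        unfolding Z1 compose_def by (auto simp: u1)
    qed
    \<comment> \<open>A representative must exist, for otherwise the union would be empty rather
      than the trivial class.\<close>
    moreover have "?J \<in> Jac_class K A (trivext_form K)"
      unfolding Jac_class_def H1_class_def
      using cohomologous_refl[OF A.units_group J] A.alg_aut_one_eval_units
      by (simp add: A.carrier_Alg_Aut)
    ultimately show "H1_res ?Z (units_of A) (eval_units A) ?u (Jac_class K A (trivext_form K)) =
        H1_trivial ?Z (units_of A) (eval_units A \<circ> ?u)"
      unfolding H1_res_def H1_trivial_def by auto
  qed
qed

end
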